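(* Let $f\colon\mathbb Z_p\to\mathbb Z_p$ be uniformly differentiable modulo $p^2$ on $\mathbb Z_p$ with integer-valued derivative modulo $p^2$. Then $f$ is asymptotically ergodic if and only if $f$ is transitive modulo $p^{N_2(f)+1}$ when $p$ is odd, respectively transitive modulo $2^{N_2(f)+2}$ when $p=2$.
   Context: $\mathbb Z_p$, $\mathbb Q_p$, $\|\cdot\|_p$ are the $p$-adic integers, numbers and norm; $a\equiv b\pmod{p^s}$ means $\|a-b\|_p\le p^{-s}$. $f$ is uniformly differentiable modulo $p^k$ on $\mathbb Z_p$ if there exist $N\in\mathbb N$ and for every $u\in\mathbb Z_p$ an element $f'_k(u)\in\mathbb Q_p$ such that for every integer $K\ge N$, every $u\in\mathbb Z_p$ and every $h\in\mathbb Z_p$ with $\|h\|_p\le p^{-K}$: $f(u+h)\equiv f(u)+hf'_k(u)\pmod{p^{k+K}}$; the least such $N$ is $N_k(f)$. The derivative modulo $p^k$ is integer-valued if $f'_k(u)$ can be chosen in $\mathbb Z_p$ for every $u$. $f$ is transitive modulo $p^k$ if the map $\{0,\dots,p^k-1\}\to\mathbb Z/p^k$, $x\mapsto f(x)\bmod p^k$ (identifying $\{0,\dots,p^k-1\}$ with $\mathbb Z/p^k$) is a single-cycle permutation; $f$ is asymptotically ergodic if it is transitive modulo $p^k$ for all sufficiently large $k$. *)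

theory Defs
  imports
    "HOL-Computational_Algebra.Polynomial_Factorial"
    "HOL-Combinatorics.Orbits"
    "Berlekamp_Zassenhaus.Finite_Field"
begin

text \<open>
  The prime \<open>p\<close> is carried by a type: \<open>p = CARD('p)\<close> with \<open>'p :: prime_card\<close>.
  The \<open>p\<close>-adic integers are the inverse limit of the rings \<open>\<int>/p\<^sup>n\<close>, i.e. coherent sequences of
  least nonnegative residues, and the field of \<open>p\<close>-adic numbers is their fraction field.
\<close>

typedef (overloaded) ('p :: prime_card) padic_int =
  "{x :: nat \<Rightarrow> int. \<forall>n. x n \<in> {0..<int CARD('p) ^ n} \<and> x (Suc n) mod int CARD('p) ^ n = x n}"
  morphisms residue Abs_padic_int
  by (rule exI[of _ "\<lambda>_. 0"]) (simp add: zero_less_power)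

setup_lifting type_definition_padic_int

lemma mod_prime_power_Suc:
  "(a mod int q ^ Suc n) mod int q ^ n = a mod int q ^ n"
  by (simp add: mod_mod_cancel)

instantiation padic_int :: (prime_card) comm_ring_1
begin

lift_definition zero_padic_int :: "'a padic_int" is "\<lambda>_. 0"
  by simp

lift_definition one_padic_int :: "'a padic_int" is "\<lambda>n. 1 mod int CARD('a) ^ n"
  using mod_prime_power_Suc[of 1 "CARD('a)"] by (simp del: power_Suc)

lift_definition plus_padic_int :: "'a padic_int \<Rightarrow> 'a padic_int \<Rightarrow> 'a padic_int"
  is "\<lambda>x y n. (x n + y n) mod int CARD('a) ^ n"
  by (simp add: mod_prime_power_Suc del: power_Suc) (metis mod_add_eq)

lift_definition minus_padic_int :: "'a padic_int \<Rightarrow> 'a padic_int \<Rightarrow> 'a padic_int"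
  is "\<lambda>x y n. (x n - y n) mod int CARD('a) ^ n"
  by (simp add: mod_prime_power_Suc del: power_Suc) (metis mod_diff_eq)

lift_definition uminus_padic_int :: "'a padic_int \<Rightarrow> 'a padic_int"
  is "\<lambda>x n. (- x n) mod int CARD('a) ^ n"
  by (simp add: mod_prime_power_Suc del: power_Suc) (metis mod_minus_eq)

lift_definition times_padic_int :: "'a padic_int \<Rightarrow> 'a padic_int \<Rightarrow> 'a padic_int"
  is "\<lambda>x y n. (x n * y n) mod int CARD('a) ^ n"
  by (simp add: mod_prime_power_Suc del: power_Suc) (metis mod_mult_eq)

instance
proof
  fix a b c :: "'a padic_int"
  show "a * b * c = a * (b * c)" by transfer (simp add: mod_simps mult.assoc)
  show "a * b = b * a" by transfer (simp add: mult.commute)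
  show "1 * a = a" by transfer (simp add: mod_simps fun_eq_iff)
  show "a + b + c = a + (b + c)" by transfer (simp add: mod_simps add.assoc)
  show "a + b = b + a" by transfer (simp add: add.commute)
  show "0 + a = a" by transfer (simp add: fun_eq_iff)
  show "- a + a = 0" by transfer (simp add: mod_simps)
  show "a - b = a + - b" by transfer (simp add: mod_simps)
  show "(a + b) * c = a * c + b * c" by transfer (simp add: mod_simps distrib_right)
  show "(0 :: 'a padic_int) \<noteq> 1"
  proof
    assume "(0 :: 'a padic_int) = 1"
    then have "residue (0 :: 'a padic_int) 1 = residue 1 1" by simp
    moreover have "1 < CARD('a)" using prime_card[where 'a = 'a] by (rule prime_gt_1_nat)
    ultimately show False by transfer simp
  qed
qed

end

lemma residue_0 [simp]: "residue 0 n = 0"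
  by transfer simp

lemma residue_add: "residue (x + y :: 'p :: prime_card padic_int) n =
    (residue x n + residue y n) mod int CARD('p) ^ n"
  by transfer simp

lemma residue_diff: "residue (x - y :: 'p :: prime_card padic_int) n =
    (residue x n - residue y n) mod int CARD('p) ^ n"
  by transfer simp

lemma residue_mult: "residue (x * y :: 'p :: prime_card padic_int) n =
    (residue x n * residue y n) mod int CARD('p) ^ n"
  by transfer simp

lemma residue_bounds:
  "0 \<le> residue (x :: 'p :: prime_card padic_int) n" "residue x n < int CARD('p) ^ n"
  by (transfer; simp)+

lemma residue_of_nat:
  "residue (of_nat a :: 'p :: prime_card padic_int) n = int a mod int CARD('p) ^ n"
proof (induction a)
  case (Suc a)
  have "residue (1 :: 'p padic_int) n = 1 mod int CARD('p) ^ n" by transfer simp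
  with Suc show ?case by (simp add: residue_add mod_simps)
qed simp

lemma residue_mod:
  assumes "n \<le> m"
  shows "residue (x :: 'p :: prime_card padic_int) m mod int CARD('p) ^ n = residue x n"
  using assms
proof (induction m rule: dec_induct)
  case base
  show ?case using residue_bounds[of x n] by simp
next
  case (step m)
  have "residue x (Suc m) mod int CARD('p) ^ m = residue x m" by transfer simp
  moreover have "int CARD('p) ^ n dvd int CARD('p) ^ m"
    using step.hyps by (intro le_imp_power_dvd)
  ultimately show ?case using step.IH by (metis mod_mod_cancel)
qed

lemma padic_int_eqI: "(\<And>n. residue x n = residue y n) \<Longrightarrow> x = y"
  by (metis ext residue_inject)

definition padic_int_val :: "'p :: prime_card padic_int \<Rightarrow> nat" where
  "padic_int_val x = (LEAST n. residue x (Suc n) \<noteq> 0)"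

lemma residue_eq_0_iff:
  assumes "x \<noteq> 0"
  shows "residue x n = 0 \<longleftrightarrow> n \<le> padic_int_val (x :: 'p :: prime_card padic_int)"
proof -
  have z: "residue x 0 = 0" using residue_bounds[of x 0] by simp
  obtain m where m: "residue x m \<noteq> 0" using padic_int_eqI[of x 0] assms by auto
  with z obtain k where "m = Suc k" by (cases m) auto
  with m have ex: "residue x (Suc k) \<noteq> 0" by simp
  have l: "residue x (Suc (padic_int_val x)) \<noteq> 0"
    unfolding padic_int_val_def using ex by (rule LeastI)
  have s: "residue x (Suc j) = 0" if "j < padic_int_val x" for j
    using not_less_Least[OF that[unfolded padic_int_val_def]] by simp
  show ?thesis
  proof
    assume "residue x n = 0"
    then have "residue x i = 0" if "i \<le> n" for i using residue_mod[OF that, of x] by simp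
    with l show "n \<le> padic_int_val x" by (meson not_less_eq_eq)
  next
    assume "n \<le> padic_int_val x"
    then show "residue x n = 0" using z s by (cases n) auto
  qed
qed

lemma padic_int_val_mult_aux:
  fixes x y :: "'p :: prime_card padic_int"
  assumes "x \<noteq> 0" "y \<noteq> 0"
  defines "m \<equiv> padic_int_val x" and "l \<equiv> padic_int_val y"
  shows "residue (x * y) (m + l) = 0" "residue (x * y) (Suc (m + l)) \<noteq> 0"
proof -
  let ?p = "int CARD('p)"
  let ?N = "Suc (m + l)"
  have p: "prime ?p" using prime_card[where 'a = 'p] by simp
  have *: "\<exists>a. residue z ?N = ?p ^ padic_int_val z * a \<and> \<not> ?p dvd a"
    if "z \<noteq> 0" "padic_int_val z \<le> m + l" for z :: "'p padic_int"
  proof -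
    have "residue z ?N mod ?p ^ padic_int_val z = 0"
      using that residue_mod[of "padic_int_val z" ?N z] residue_eq_0_iff[of z] by simp
    then obtain a where a: "residue z ?N = ?p ^ padic_int_val z * a" by auto
    have "residue z ?N mod ?p ^ Suc (padic_int_val z) \<noteq> 0"
      using that residue_mod[of "Suc (padic_int_val z)" ?N z] residue_eq_0_iff[of z]
      by (simp del: power_Suc)
    with a have "\<not> ?p dvd a" by (auto simp: mod_eq_0_iff_dvd mult.commute)
    with a show ?thesis by blast
  qed
  obtain a where a: "residue x ?N = ?p ^ m * a" "\<not> ?p dvd a"
    using *[of x] assms by (auto simp: m_def)
  obtain b where b: "residue y ?N = ?p ^ l * b" "\<not> ?p dvd b"
    using *[of y] assms by (auto simp: l_def)
  have ab: "residue x ?N * residue y ?N = ?p ^ (m + l) * (a * b)"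
    by (simp add: a b power_add)
  have "\<not> ?p dvd a * b" using a b p by (simp add: prime_dvd_mult_iff)
  then have "\<not> ?p ^ ?N dvd ?p ^ (m + l) * (a * b)"
    by (simp add: mult.commute)
  then show "residue (x * y) ?N \<noteq> 0"
    by (simp add: residue_mult ab mod_eq_0_iff_dvd del: power_Suc)
  have "residue (x * y) (m + l) = residue (x * y) ?N mod ?p ^ (m + l)"
    by (rule residue_mod[symmetric]) simp
  also have "\<dots> = ?p ^ (m + l) * (a * b) mod ?p ^ (m + l)"
    unfolding residue_mult ab by (rule mod_prime_power_Suc)
  finally show "residue (x * y) (m + l) = 0" by simp
qed

instance padic_int :: (prime_card) idom
proof
  fix x y :: "'a padic_int"
  assume "x \<noteq> 0" "y \<noteq> 0"
  then show "x * y \<noteq> 0" using padic_int_val_mult_aux(2) by fastforce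
qed

lemma padic_int_val_mult:
  fixes x y :: "'p :: prime_card padic_int"
  assumes "x \<noteq> 0" "y \<noteq> 0"
  shows "padic_int_val (x * y) = padic_int_val x + padic_int_val y"
  using padic_int_val_mult_aux[OF assms] assms
  by (simp add: residue_eq_0_iff)

type_synonym 'p padic = "'p padic_int fract"

definition padic_int_norm :: "'p :: prime_card padic_int \<Rightarrow> real" where
  "padic_int_norm x = (if x = 0 then 0 else real CARD('p) powi (- int (padic_int_val x)))"

lemma padic_int_norm_mult:
  "padic_int_norm (x * y) = padic_int_norm x * padic_int_norm (y :: 'p :: prime_card padic_int)"
  by (simp add: padic_int_norm_def padic_int_val_mult power_int_add[symmetric])

lemma padic_int_norm_eq_0_iff [simp]:
  "padic_int_norm (x :: 'p :: prime_card padic_int) = 0 \<longleftrightarrow> x = 0"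
  by (simp add: padic_int_norm_def)

definition padic_norm :: "'p :: prime_card padic \<Rightarrow> real" where
  "padic_norm q = (THE r. \<exists>a b. b \<noteq> 0 \<and> q = Fract a b \<and> r = padic_int_norm a / padic_int_norm b)"

lemma padic_norm_Fract:
  fixes a b :: "'p :: prime_card padic_int"
  assumes "b \<noteq> 0"
  shows "padic_norm (Fract a b) = padic_int_norm a / padic_int_norm b"
  unfolding padic_norm_def
proof (rule the_equality)
  fix r
  assume "\<exists>c d. d \<noteq> 0 \<and> Fract a b = Fract c d \<and> r = padic_int_norm c / padic_int_norm d"
  then obtain c d where d: "d \<noteq> 0" "a * d = c * b" and r: "r = padic_int_norm c / padic_int_norm d"
    using assms by (auto simp: eq_fract)
  from d(2) have "padic_int_norm a * padic_int_norm d = padic_int_norm c * padic_int_norm b"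
    by (simp flip: padic_int_norm_mult)
  with assms d(1) show "r = padic_int_norm a / padic_int_norm b"
    by (simp add: r frac_eq_eq)
qed (use assms in blast)

definition padic_cong :: "'p :: prime_card padic \<Rightarrow> 'p padic \<Rightarrow> nat \<Rightarrow> bool" where
  "padic_cong a b s \<longleftrightarrow> padic_norm (a - b) \<le> real CARD('p) powi (- int s)"

lemma padic_norm_to_fract:
  "padic_norm (to_fract x) = padic_int_norm (x :: 'p :: prime_card padic_int)"
proof -
  have "padic_int_norm (1 :: 'p padic_int) * padic_int_norm (1 :: 'p padic_int)
      = padic_int_norm (1 :: 'p padic_int)"
    by (simp flip: padic_int_norm_mult)
  then have "padic_int_norm (1 :: 'p padic_int) = 1" by simp
  then show ?thesis
    by (simp add: to_fract_def padic_norm_Fract)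
qed

lemma padic_norm_to_fract_le_iff:
  "padic_norm (to_fract x) \<le> real CARD('p) powi (- int s) \<longleftrightarrow>
    residue (x :: 'p :: prime_card padic_int) s = 0"
proof -
  have "1 < real CARD('p)"
    using prime_gt_1_nat[OF prime_card[where 'a = 'p]] by simp
  then show ?thesis
    by (auto simp: padic_norm_to_fract padic_int_norm_def residue_eq_0_iff
        power_int_minus)
qed

lemma padic_cong_to_fract_iff:
  "padic_cong (to_fract x) (to_fract y) s \<longleftrightarrow>
    residue x s = residue (y :: 'p :: prime_card padic_int) s"
proof -
  have "padic_cong (to_fract x) (to_fract y) s \<longleftrightarrow> residue (x - y) s = 0"
    unfolding padic_cong_def padic_norm_to_fract_le_iff[symmetric] by simp
  also have "\<dots> \<longleftrightarrow> residue x s mod int CARD('p) ^ s = residue y s mod int CARD('p) ^ s"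
    by (simp add: residue_diff mod_eq_dvd_iff mod_eq_0_iff_dvd)
  finally show ?thesis by (simp add: residue_bounds)
qed

text \<open>
  \<open>has_derivative_mod k f N f'\<close>: the function \<open>f'\<close> is a derivative of \<open>f\<close> modulo \<open>p\<^sup>k\<close>,
  with \<open>N\<close> as a uniform bound.
\<close>

definition has_derivative_mod ::
  "nat \<Rightarrow> ('p :: prime_card padic_int \<Rightarrow> 'p padic_int) \<Rightarrow> nat \<Rightarrow> ('p padic_int \<Rightarrow> 'p padic) \<Rightarrow> bool"
where
  "has_derivative_mod k f N f' \<longleftrightarrow>
    (\<forall>K\<ge>N. \<forall>u h. padic_norm (to_fract h) \<le> real CARD('p) powi (- int K) \<longrightarrow>
      padic_cong (to_fract (f (u + h))) (to_fract (f u) + to_fract h * f' u) (k + K))"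

definition uniformly_differentiable_mod ::
  "nat \<Rightarrow> ('p :: prime_card padic_int \<Rightarrow> 'p padic_int) \<Rightarrow> bool" where
  "uniformly_differentiable_mod k f \<longleftrightarrow> (\<exists>N f'. has_derivative_mod k f N f')"

definition N_mod :: "nat \<Rightarrow> ('p :: prime_card padic_int \<Rightarrow> 'p padic_int) \<Rightarrow> nat" where
  "N_mod k f = (LEAST N. \<exists>f'. has_derivative_mod k f N f')"

definition integer_valued_derivative_mod ::
  "nat \<Rightarrow> ('p :: prime_card padic_int \<Rightarrow> 'p padic_int) \<Rightarrow> bool" where
  "integer_valued_derivative_mod k f \<longleftrightarrow>
    (\<exists>N f'. has_derivative_mod k f N f' \<and> (\<forall>u. f' u \<in> range to_fract))"

definition reduction_mod ::
  "nat \<Rightarrow> ('p :: prime_card padic_int \<Rightarrow> 'p padic_int) \<Rightarrow> nat \<Rightarrow> nat" where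
  "reduction_mod k f x = nat (residue (f (of_nat x)) k)"

definition transitive_mod ::
  "nat \<Rightarrow> ('p :: prime_card padic_int \<Rightarrow> 'p padic_int) \<Rightarrow> bool" where
  "transitive_mod k f \<longleftrightarrow>
    bij_betw (reduction_mod k f) {..<CARD('p) ^ k} {..<CARD('p) ^ k} \<and>
    cyclic_on (reduction_mod k f) {..<CARD('p) ^ k}"

definition asymptotically_ergodic ::
  "('p :: prime_card padic_int \<Rightarrow> 'p padic_int) \<Rightarrow> bool" where
  "asymptotically_ergodic f \<longleftrightarrow> (\<exists>k\<^sub>0. \<forall>k\<ge>k\<^sub>0. transitive_mod k f)"

end

theory Submission
  imports Defs "HOL-Number_Theory.Residues"
begin

text \<open>
  The orbit of \<open>0\<close> detects transitivity: for \<open>k \<ge> N\<close> the function \<open>f\<close> acts on \<open>\<int>/p\<^sup>k\<close>, and it is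
  transitive there iff \<open>f\<^sup>i 0 \<equiv> 0 (mod p\<^sup>k)\<close> holds exactly for \<open>p\<^sup>k dvd i\<close>.
  Suppose \<open>f\<close> is transitive modulo \<open>p\<^bsup>M+1\<^esup>\<close> with \<open>M \<ge> N\<close>, and let \<open>g\<close> be the iterate of \<open>f\<close> of
  order \<open>p\<^sup>M\<close>. By the chain rule \<open>g\<close> is affine on \<open>p\<^sup>M\<int>\<^sub>p\<close> modulo \<open>p\<^bsup>M+2\<^esup>\<close>, say
  \<open>g h \<equiv> p\<^sup>M m + h n\<close>, hence \<open>g\<^sup>j 0 \<equiv> p\<^sup>M m (1 + n + \<dots> + n\<^bsup>j-1\<^esup>)\<close>. Transitivity modulo \<open>p\<^bsup>M+1\<^esup>\<close>
  forces \<open>m\<close> to be a unit and \<open>n \<equiv> 1 (mod p)\<close>, so for odd \<open>p\<close> the geometric sum of length \<open>p\<close> is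
  \<open>p\<close> modulo \<open>p\<^sup>2\<close>, and \<open>g\<^sup>p\<close> is translation by \<open>p\<^bsup>M+1\<^esup> m\<close> on \<open>p\<^bsup>M+1\<^esup>\<int>\<^sub>p\<close> modulo \<open>p\<^bsup>M+2\<^esup>\<close>. This gives
  transitivity modulo \<open>p\<^bsup>M+2\<^esup>\<close>. For \<open>p = 2\<close> one needs \<open>n \<equiv> 1 (mod 4)\<close>, which holds if
  \<open>M > N\<close> because \<open>n\<close> is then the square of an odd number modulo 4.
\<close>

section \<open>Congruences as divisibility by powers of p in the p-adic integers\<close>

abbreviation padic_p :: "'p :: prime_card padic_int" where
  "padic_p \<equiv> of_nat CARD('p)"

text \<open>The quotient is built by hand: shifting the residues of \<open>x\<close> by
  \<open>s\<close> places and dividing by p^s gives again a coherent sequence. This moves later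
  arguments from residues and norms to \<open>dvd\<close> in a ring.\<close>

lemma residue_eq_0_iff_dvd:
  "residue (x :: 'p :: prime_card padic_int) s = 0 \<longleftrightarrow> padic_p ^ s dvd x"
proof
  let ?p = "int CARD('p)"
  assume x: "residue x s = 0"
  define r where "r n = residue x (n + s) div ?p ^ s" for n
  have p: "0 < ?p" by simp
  have bounds: "r n \<in> {0..<?p ^ n}" for n
  proof -
    have "residue x (n + s) < ?p ^ n * ?p ^ s"
      using residue_bounds(2)[of x "n + s"] by (simp add: power_add)
    moreover have "?p ^ s * r n \<le> residue x (n + s)"
      using mult_div_mod_eq[of "?p ^ s" "residue x (n + s)"]
        pos_mod_sign[of "?p ^ s" "residue x (n + s)"] p
      unfolding r_def by (smt (verit) zero_less_power)
    ultimately have "?p ^ s * r n < ?p ^ s * ?p ^ n"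
      by (metis le_less_trans mult.commute)
    then have "r n < ?p ^ n" by simp
    moreover have "0 \<le> r n"
      unfolding r_def using p residue_bounds(1)[of x "n + s"] by (simp add: pos_imp_zdiv_nonneg_iff)
    ultimately show ?thesis by simp
  qed
  have coherent: "r (Suc n) mod ?p ^ n = r n" for n
  proof -
    have "residue x (n + s) = residue x (Suc n + s) mod (?p ^ s * ?p ^ n)"
      using residue_mod[of "n + s" "Suc n + s" x] by (simp add: power_add mult.commute)
    also have "\<dots> = ?p ^ s * (residue x (Suc n + s) div ?p ^ s mod ?p ^ n)
        + residue x (Suc n + s) mod ?p ^ s"
      by (rule zmod_zmult2_eq) simp
    finally show ?thesis
      using residue_mod[of s "Suc n + s" x] x by (simp add: r_def)
  qed
  have res: "residue (Abs_padic_int r :: 'p padic_int) = r"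
    by (rule Abs_padic_int_inverse) (use bounds coherent in blast)
  have "x = padic_p ^ s * Abs_padic_int r"
  proof (rule padic_int_eqI)
    fix n
    have "?p ^ s * r n = residue x (n + s)"
      using residue_mod[of s "n + s" x] x by (auto simp: r_def)
    then have "residue x n = (?p ^ s * r n) mod ?p ^ n"
      using residue_mod[of n "n + s" x] by simp
    then have "residue x n = residue (of_nat (CARD('p) ^ s) * Abs_padic_int r :: 'p padic_int) n"
      unfolding residue_mult residue_of_nat res by (simp add: mod_mult_left_eq)
    then show "residue x n = residue (padic_p ^ s * Abs_padic_int r :: 'p padic_int) n" by simp
  qed
  then show "padic_p ^ s dvd x" by (rule dvdI)
next
  assume "padic_p ^ s dvd x"
  then obtain y where y: "x = of_nat (CARD('p) ^ s) * y" by (auto elim: dvdE)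
  show "residue x s = 0" by (simp only: y residue_mult residue_of_nat) simp
qed

lemma residue_eq_iff_dvd:
  "residue x s = residue (y :: 'p :: prime_card padic_int) s \<longleftrightarrow> padic_p ^ s dvd x - y"
proof -
  have "padic_cong (to_fract x) (to_fract y) s \<longleftrightarrow> residue (x - y) s = 0"
    unfolding padic_cong_def padic_norm_to_fract_le_iff[symmetric] by simp
  then show ?thesis by (simp add: padic_cong_to_fract_iff residue_eq_0_iff_dvd)
qed

lemma padic_p_power_dvd_of_nat_diff_iff:
  "padic_p ^ s dvd of_nat a - (of_nat b :: 'p :: prime_card padic_int) \<longleftrightarrow>
    [a = b] (mod CARD('p) ^ s)"
  unfolding residue_eq_iff_dvd[symmetric] residue_of_nat cong_def
  by (simp flip: of_nat_power of_nat_mod)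

lemma padic_p_power_dvd_of_nat_iff:
  "padic_p ^ s dvd (of_nat a :: 'p :: prime_card padic_int) \<longleftrightarrow> CARD('p) ^ s dvd a"
  using padic_p_power_dvd_of_nat_diff_iff[of s a 0] by (simp add: cong_0_iff)

lemma padic_int_approx_nat:
  obtains a :: nat where "padic_p ^ s dvd x - (of_nat a :: 'p :: prime_card padic_int)"
proof
  show "padic_p ^ s dvd x - of_nat (nat (residue x s))"
    unfolding residue_eq_iff_dvd[symmetric] residue_of_nat
    using residue_bounds[of x s] by simp
qed

lemma padic_p_nonzero [simp]: "(padic_p :: 'p :: prime_card padic_int) \<noteq> 0"
proof
  assume "(padic_p :: 'p padic_int) = 0"
  then have "CARD('p) ^ 2 dvd CARD('p) ^ 1"
    using padic_p_power_dvd_of_nat_iff[where 'p = 'p, of 2 "CARD('p)"] by simp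
  then show False
    using prime_gt_1_nat[OF prime_card[where 'a = 'p]] by (meson not_less numeral_le_one_iff one_less_numeral_iff power_dvd_imp_le semiring_norm(76))
qed

text \<open>Valuations add under multiplication. This clears and cancels the denominators of
  derivative values.\<close>

lemma padic_p_power_dvd_mult_iff:
  assumes "b \<noteq> 0"
  shows "padic_p ^ (s + padic_int_val b) dvd x * b \<longleftrightarrow>
    padic_p ^ s dvd (x :: 'p :: prime_card padic_int)"
  using assms
  by (cases "x = 0") (simp_all add: residue_eq_0_iff padic_int_val_mult flip: residue_eq_0_iff_dvd)

section \<open>Integral derivatives modulo p^k and the chain rule\<close>

text \<open>The counterpart of \<open>has_derivative_mod\<close> for integer-valued derivatives,
  free of fractions and norms.\<close>

definition integral_derivative_mod ::
  "nat \<Rightarrow> ('p :: prime_card padic_int \<Rightarrow> 'p padic_int) \<Rightarrow> nat \<Rightarrow> ('p padic_int \<Rightarrow> 'p padic_int) \<Rightarrow> bool"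
where
  "integral_derivative_mod k f N D \<longleftrightarrow>
    (\<forall>K\<ge>N. \<forall>u h. padic_p ^ K dvd h \<longrightarrow> padic_p ^ (k + K) dvd f (u + h) - f u - h * D u)"

lemma integral_derivative_modD:
  assumes "integral_derivative_mod k f N D" "N \<le> K" "padic_p ^ K dvd h"
  shows "padic_p ^ (k + K) dvd f (u + h) - f u - h * D u"
  using assms by (simp add: integral_derivative_mod_def)

text \<open>The difference of the two sides is a fraction with denominator \<open>b\<close>, so
  clearing it raises the exponent by the valuation of \<open>b\<close>.\<close>

lemma padic_cong_to_fract_mult_Fract_iff:
  fixes x y h a b :: "'p :: prime_card padic_int"
  assumes "b \<noteq> 0"
  shows "padic_cong (to_fract x) (to_fract y + to_fract h * Fract a b) s \<longleftrightarrow>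
    padic_p ^ (s + padic_int_val b) dvd (x - y) * b - h * a"
proof -
  define c where "c = (x - y) * b - h * a"
  have p: "1 < real CARD('p)"
    using prime_gt_1_nat[OF prime_card[where 'a = 'p]] by simp
  have "to_fract x - (to_fract y + to_fract h * Fract a b) = Fract c b"
    using assms by (simp add: to_fract_def c_def eq_fract algebra_simps)
  then have "padic_cong (to_fract x) (to_fract y + to_fract h * Fract a b) s \<longleftrightarrow>
      padic_int_norm c / padic_int_norm b \<le> real CARD('p) powi (- int s)"
    using assms by (simp add: padic_cong_def padic_norm_Fract)
  also have "\<dots> \<longleftrightarrow> padic_int_norm c \<le> real CARD('p) powi (- int (s + padic_int_val b))"
    using assms p
    by (simp add: padic_int_norm_def power_int_minus divide_le_eq power_add field_simps
        flip: of_nat_add)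
  also have "\<dots> \<longleftrightarrow> padic_p ^ (s + padic_int_val b) dvd c"
    by (simp only: padic_norm_to_fract[symmetric] padic_norm_to_fract_le_iff residue_eq_0_iff_dvd)
  finally show ?thesis by (simp add: c_def)
qed

lemma has_derivative_mod_to_fract_iff:
  "has_derivative_mod k f N (\<lambda>u. to_fract (D u)) \<longleftrightarrow> integral_derivative_mod k f N D"
  unfolding has_derivative_mod_def integral_derivative_mod_def
  by (simp add: padic_norm_to_fract_le_iff padic_cong_to_fract_iff residue_eq_0_iff_dvd
      residue_eq_iff_dvd algebra_simps flip: to_fract_mult to_fract_add)

text \<open>
  Evaluating at a single small increment shows that two derivatives modulo \<open>p\<^sup>k\<close> agree modulo
  \<open>p\<^sup>k\<close>, so an integral one is valid with the bound \<open>N\<close> of any other one.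
\<close>

lemma integral_derivative_mod_bound:
  fixes f :: "'p :: prime_card padic_int \<Rightarrow> 'p padic_int"
  assumes D: "integral_derivative_mod k f N' D" and f': "has_derivative_mod k f N f'"
  shows "integral_derivative_mod k f N D"
  unfolding integral_derivative_mod_def
proof (intro allI impI)
  fix K and u h :: "'p padic_int"
  assume K: "N \<le> K" and h: "padic_p ^ K dvd h"
  obtain a b where ab: "f' u = Fract a b" "b \<noteq> 0"
    by (cases "f' u") auto
  define v where "v = padic_int_val b"
  have f'_dvd: "padic_p ^ (k + L + v) dvd (f (u + d) - f u) * b - d * a"
    if "N \<le> L" "padic_p ^ L dvd d" for L d
  proof -
    have "padic_cong (to_fract (f (u + d))) (to_fract (f u) + to_fract d * f' u) (k + L)"
      using f' that
      by (simp add: has_derivative_mod_def padic_norm_to_fract_le_iff residue_eq_0_iff_dvd)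
    with ab show ?thesis
      by (simp add: padic_cong_to_fract_mult_Fract_iff v_def)
  qed
  \<comment> \<open>At this scale the expansions by \<open>D\<close> and by \<open>f'\<close> are
    both available.\<close>
  define L where "L = max N N'"
  let ?d = "padic_p ^ L :: 'p padic_int"
  have "padic_p ^ (k + L + v) dvd (f (u + ?d) - f u - ?d * D u) * b"
    using integral_derivative_modD[OF D, of L ?d u] ab
    by (simp add: v_def L_def padic_p_power_dvd_mult_iff)
  moreover have "padic_p ^ (k + L + v) dvd (f (u + ?d) - f u) * b - ?d * a"
    by (rule f'_dvd) (simp_all add: L_def)
  ultimately have "padic_p ^ (k + L + v) dvd
      ((f (u + ?d) - f u - ?d * D u) * b) - ((f (u + ?d) - f u) * b - ?d * a)"
    by (rule dvd_diff)
  then have "padic_p ^ L * padic_p ^ (k + v) dvd padic_p ^ L * (a - D u * b)"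
    by (simp add: algebra_simps power_add)
  \<comment> \<open>With the denominator \<open>b\<close> cleared, this says that
    \<open>f' u\<close> and \<open>D u\<close> agree modulo p^k.\<close>
  then have "padic_p ^ (k + v) dvd a - D u * b"
    by (simp del: of_nat_power)
  then have "padic_p ^ K * padic_p ^ (k + v) dvd h * (a - D u * b)"
    using h by (rule mult_dvd_mono[rotated])
  then have "padic_p ^ (k + K + v) dvd h * (a - D u * b)"
    by (simp add: power_add ac_simps)
  with f'_dvd[OF K h] have
    "padic_p ^ (k + K + v) dvd ((f (u + h) - f u) * b - h * a) + h * (a - D u * b)"
    by (rule dvd_add)
  then have "padic_p ^ (k + K + v) dvd (f (u + h) - f u - h * D u) * b"
    by (simp add: algebra_simps)
  then show "padic_p ^ (k + K) dvd f (u + h) - f u - h * D u"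
    using ab by (simp add: v_def padic_p_power_dvd_mult_iff)
qed

text \<open>An integer-valued derivative may come with a bound above \<open>N_mod k f\<close>, and
  the derivative attaining \<open>N_mod k f\<close> may have non-integral values;
  \<open>integral_derivative_mod_bound\<close> combines the two.\<close>

lemma integral_derivative_mod_N_mod:
  assumes "uniformly_differentiable_mod k f" "integer_valued_derivative_mod k f"
  obtains D where "integral_derivative_mod k f (N_mod k f) D"
proof -
  from assms(2) obtain N f' where f': "has_derivative_mod k f N f'" "\<forall>u. f' u \<in> range to_fract"
    by (auto simp: integer_valued_derivative_mod_def)
  define D where "D u = (SOME d. f' u = to_fract d)" for u
  have "f' u = to_fract (D u)" for u
    unfolding D_def by (rule someI_ex) (use f'(2) in blast)
  then have "f' = (\<lambda>u. to_fract (D u))" by (rule ext)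
  with f'(1) have D: "integral_derivative_mod k f N D"
    using has_derivative_mod_to_fract_iff by metis
  have "\<exists>g. has_derivative_mod k f (N_mod k f) g"
    unfolding N_mod_def by (rule LeastI_ex) (use f'(1) in blast)
  with integral_derivative_mod_bound[OF D] that show thesis by blast
qed

text \<open>Integrality of \<open>D\<close> makes the linear term divisible by p^K. Hence
  \<open>f\<close> acts on residues modulo p^K for every \<open>K\<close> from \<open>N\<close>
  on.\<close>

lemma integral_derivative_mod_cong:
  assumes "integral_derivative_mod k f N D" "N \<le> K" "padic_p ^ K dvd x - y"
  shows "padic_p ^ K dvd f x - f y"
proof -
  have "padic_p ^ (k + K) dvd f x - f y - (x - y) * D y"
    using integral_derivative_modD[OF assms, of y] by simp
  then have "padic_p ^ K dvd f x - f y - (x - y) * D y"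
    by (rule power_le_dvd) simp
  then have "padic_p ^ K dvd f x - f y - (x - y) * D y + (x - y) * D y"
    using assms(3) by (intro dvd_add dvd_mult2)
  then show ?thesis by simp
qed

text \<open>The chain rule. The bound \<open>N\<close> survives because \<open>g\<close> maps an
  increment divisible by p^K to one divisible by p^K.\<close>

lemma integral_derivative_mod_comp:
  fixes f :: "'p :: prime_card padic_int \<Rightarrow> 'p padic_int"
  assumes f: "integral_derivative_mod k f N D" and g: "integral_derivative_mod k g N E"
  shows "integral_derivative_mod k (f \<circ> g) N (\<lambda>u. D (g u) * E u)"
  unfolding integral_derivative_mod_def
proof (intro allI impI)
  fix K and u h :: "'p padic_int"
  assume K: "N \<le> K" and h: "padic_p ^ K dvd h"
  define d where "d = g (u + h) - g u"
  have 1: "padic_p ^ (k + K) dvd d - h * E u"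
    using integral_derivative_modD[OF g K h] by (simp add: d_def)
  have "padic_p ^ K dvd d"
    unfolding d_def by (rule integral_derivative_mod_cong[OF g K]) (use h in simp)
  then have "padic_p ^ (k + K) dvd f (g u + d) - f (g u) - d * D (g u)"
    by (rule integral_derivative_modD[OF f K])
  moreover have "padic_p ^ (k + K) dvd (d - h * E u) * D (g u)"
    using 1 by (rule dvd_mult2)
  ultimately have "padic_p ^ (k + K) dvd
      (f (g u + d) - f (g u) - d * D (g u)) + (d - h * E u) * D (g u)"
    by (rule dvd_add)
  then show "padic_p ^ (k + K) dvd (f \<circ> g) (u + h) - (f \<circ> g) u - h * (D (g u) * E u)"
    by (simp add: d_def algebra_simps)
qed

lemma integral_derivative_mod_funpow:
  assumes "integral_derivative_mod k f N D"
  obtains E where "integral_derivative_mod k (f ^^ n) N E"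
proof -
  have "\<exists>E. integral_derivative_mod k (f ^^ n) N E"
  proof (induction n)
    case 0
    have "integral_derivative_mod k (f ^^ 0) N (\<lambda>_. 1)"
      by (simp add: integral_derivative_mod_def)
    then show ?case by blast
  next
    case (Suc n)
    then show ?case
      unfolding funpow.simps using integral_derivative_mod_comp[OF assms] by blast
  qed
  with that show thesis by blast
qed

text \<open>The increment from \<open>u\<close> to \<open>u + h + p^N\<close> is expanded directly
  and through \<open>u + h\<close>. Comparison leaves p^N times the difference of the derivatives,
  divisible by p^(k+N).\<close>

lemma integral_derivative_mod_periodic:
  assumes f: "integral_derivative_mod k f N D" and h: "padic_p ^ N dvd h"
  shows "padic_p ^ k dvd D (u + h) - D u"
proof -
  let ?d = "padic_p ^ N :: 'a padic_int"
  note dvdD = integral_derivative_modD[OF f order_refl]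
  have "padic_p ^ (k + N) dvd (f (u + (h + ?d)) - f u - (h + ?d) * D u)
      - (f (u + h + ?d) - f (u + h) - ?d * D (u + h)) - (f (u + h) - f u - h * D u)"
    by (intro dvd_diff dvdD h dvd_add dvd_refl)
  then have "padic_p ^ N * padic_p ^ k dvd padic_p ^ N * (D (u + h) - D u)"
    by (simp add: algebra_simps power_add)
  then show ?thesis by (simp del: of_nat_power)
qed

section \<open>Orbits, return times and transitivity\<close>

text \<open>\<open>orbit F x\<close> starts at \<open>F x\<close>, so each of its elements is a
  value of \<open>F\<close> on \<open>x\<close> or on the orbit. If the orbit is \<open>A\<close>,
  then \<open>F\<close> is onto \<open>A\<close>, hence injective by finiteness.\<close>

lemma bij_betw_cyclic_on_iff_orbit:
  assumes "finite A" "x \<in> A"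
  shows "bij_betw F A A \<and> cyclic_on F A \<longleftrightarrow> orbit F x = A"
proof
  assume "bij_betw F A A \<and> cyclic_on F A"
  then show "orbit F x = A" using assms(2) orbit_cyclic_eq3 by metis
next
  assume orb: "orbit F x = A"
  then have "cyclic_on F A" using assms(2) by (auto simp: cyclic_on_def)
  moreover have "F ` A = A"
  proof
    show "F ` A \<subseteq> A" using orb by (auto intro: orbit.step)
    show "A \<subseteq> F ` A"
    proof
      fix y assume "y \<in> A"
      then have "y \<in> orbit F x" using orb by simp
      then show "y \<in> F ` A" by cases (use orb assms(2) in auto)
    qed
  qed
  then have "bij_betw F A A"
    using assms(1) by (metis bij_betw_def eq_card_imp_inj_on)
  ultimately show "bij_betw F A A \<and> cyclic_on F A" by simp
qed

text \<open>If the orbit fills \<open>A\<close>, the first return time is \<open>card A\<close>.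
  Conversely, the return times make the first \<open>card A\<close> iterates distinct, and these
  exhaust \<open>A\<close>.\<close>

lemma orbit_eq_iff_return_times:
  assumes A: "finite A" "x \<in> A" and F: "F ` A \<subseteq> A"
  shows "orbit F x = A \<longleftrightarrow> (\<forall>i. (F ^^ i) x = x \<longleftrightarrow> card A dvd i)"
proof
  assume orb: "orbit F x = A"
  then have self: "x \<in> orbit F x" using A by simp
  let ?d = "funpow_dist1 F x x"
  have "card A = ?d"
    using orbit_conv_funpow_dist1[OF self] inj_on_funpow_dist1[OF self] orb
    by (simp add: card_image)
  moreover have "(F ^^ i) x = x \<longleftrightarrow> ?d dvd i" for i
  proof -
    have "(F ^^ i) x = (F ^^ (i mod ?d)) x"
      using funpow_dist1_prop[OF self] by (simp only: funpow_mod_eq)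
    moreover have "(F ^^ (i mod ?d)) x \<noteq> x" if "0 < i mod ?d"
      using that by (intro funpow_dist1_least) simp_all
    ultimately show ?thesis
      by (cases "i mod ?d = 0") (auto simp: dvd_eq_mod_eq_0 simp del: funpow.simps)
  qed
  ultimately show "\<forall>i. (F ^^ i) x = x \<longleftrightarrow> card A dvd i" by simp
next
  assume ret: "\<forall>i. (F ^^ i) x = x \<longleftrightarrow> card A dvd i"
  let ?m = "card A"
  have m: "0 < ?m" using A card_gt_0_iff by blast
  have self: "(F ^^ ?m) x = x" using ret by simp
  have orb: "orbit F x = (\<lambda>i. (F ^^ i) x) ` {..<?m}"
    using orbit_altdef_bounded[OF self m] by auto
  have False if ij: "i < j" "j < ?m" "(F ^^ i) x = (F ^^ j) x" for i j
  proof -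
    \<comment> \<open>Advancing the coincidence by \<open>?m - j\<close> steps produces a return at
      a time strictly between 0 and \<open>?m\<close>.\<close>
    have "(F ^^ (?m - j + i)) x = (F ^^ (?m - j + j)) x"
      using ij(3) by (simp only: funpow_add comp_apply)
    then have "?m dvd ?m - j + i" using ret self ij by simp
    then show False using ij by (auto dest: dvd_imp_le)
  qed
  then have "inj_on (\<lambda>i. (F ^^ i) x) {..<?m}"
    by (intro inj_onI) (metis lessThan_iff linorder_neqE_nat)
  then have "card (orbit F x) = ?m" by (simp add: orb card_image)
  moreover have "(F ^^ i) x \<in> A" for i
    by (induction i) (use A F in auto)
  then have "orbit F x \<subseteq> A" using orb by auto
  ultimately show "orbit F x = A" using A by (simp add: card_subset_eq)
qed

lemma reduction_mod_less: "reduction_mod k f x < CARD('p) ^ k"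
  for f :: "'p :: prime_card padic_int \<Rightarrow> 'p padic_int"
  using residue_bounds[of "f (of_nat x)" k]
  by (simp add: reduction_mod_def nat_less_iff)

text \<open>Replacing an iterate by its least residue is harmless, since \<open>f\<close> respects
  congruence modulo p^k.\<close>

lemma funpow_reduction_mod:
  fixes f :: "'p :: prime_card padic_int \<Rightarrow> 'p padic_int"
  assumes f: "integral_derivative_mod l f N D" and k: "N \<le> k"
  shows "(reduction_mod k f ^^ i) 0 = nat (residue ((f ^^ i) 0) k)"
proof (induction i)
  case (Suc i)
  let ?x = "(f ^^ i) 0"
  have "residue (of_nat (nat (residue ?x k)) :: 'p padic_int) k = residue ?x k"
    unfolding residue_of_nat using residue_bounds[of ?x k] by simp
  then have "padic_p ^ k dvd of_nat (nat (residue ?x k)) - ?x"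
    by (simp add: residue_eq_iff_dvd)
  then have "padic_p ^ k dvd f (of_nat (nat (residue ?x k))) - f ?x"
    by (rule integral_derivative_mod_cong[OF f k])
  then have "residue (f (of_nat (nat (residue ?x k)))) k = residue (f ?x) k"
    by (simp add: residue_eq_iff_dvd)
  then show ?case using Suc by (simp add: reduction_mod_def)
qed simp

lemma transitive_mod_iff_orbit:
  "transitive_mod k f \<longleftrightarrow> orbit (reduction_mod k f) 0 = {..<CARD('p) ^ k}"
  for f :: "'p :: prime_card padic_int \<Rightarrow> 'p padic_int"
  unfolding transitive_mod_def by (rule bij_betw_cyclic_on_iff_orbit) simp_all

lemma transitive_mod_iff_return_times:
  fixes f :: "'p :: prime_card padic_int \<Rightarrow> 'p padic_int"
  assumes f: "integral_derivative_mod l f N D" and k: "N \<le> k"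
  shows "transitive_mod k f \<longleftrightarrow> (\<forall>i. padic_p ^ k dvd (f ^^ i) 0 \<longleftrightarrow> CARD('p) ^ k dvd i)"
proof -
  have "(reduction_mod k f ^^ i) 0 = 0 \<longleftrightarrow> padic_p ^ k dvd (f ^^ i) 0" for i
    using residue_bounds(1)[of "(f ^^ i) 0" k]
    by (simp add: funpow_reduction_mod[OF f k] flip: residue_eq_0_iff_dvd)
  then show ?thesis
    unfolding transitive_mod_iff_orbit
    by (subst orbit_eq_iff_return_times) (auto simp: reduction_mod_less)
qed

text \<open>A residue below p^k is also one below p^k', so the orbit at the higher level reaches it;
  reducing modulo p^k leaves it unchanged.\<close>

lemma transitive_mod_antimono:
  fixes f :: "'p :: prime_card padic_int \<Rightarrow> 'p padic_int"
  assumes f: "integral_derivative_mod l f N D" and k: "N \<le> k" "k \<le> k'"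
    and trans: "transitive_mod k' f"
  shows "transitive_mod k f"
  unfolding transitive_mod_iff_orbit
proof (intro subset_antisym subsetI)
  fix a assume "a \<in> orbit (reduction_mod k f) 0"
  then show "a \<in> {..<CARD('p) ^ k}" by cases (simp_all add: reduction_mod_less)
next
  fix a assume a: "a \<in> {..<CARD('p) ^ k}"
  also have "{..<CARD('p) ^ k} \<subseteq> {..<CARD('p) ^ k'}"
    using k by (simp add: power_increasing)
  also have "\<dots> = orbit (reduction_mod k' f) 0"
    using trans by (simp add: transitive_mod_iff_orbit)
  finally obtain i where i: "0 < i" "a = (reduction_mod k' f ^^ i) 0"
    by (auto simp: orbit_altdef)
  then have "int a = residue ((f ^^ i) 0) k'"
    using residue_bounds(1)[of "(f ^^ i) 0" k'] k by (simp add: funpow_reduction_mod[OF f])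
  then have "residue ((f ^^ i) 0) k = int a mod int CARD('p) ^ k"
    using residue_mod[OF k(2), of "(f ^^ i) 0"] by simp
  also have "\<dots> = int a" using a by (simp flip: of_nat_power)
  finally have "a = (reduction_mod k f ^^ i) 0"
    using k by (simp add: funpow_reduction_mod[OF f])
  with i(1) show "a \<in> orbit (reduction_mod k f) 0" unfolding orbit_altdef by blast
qed

section \<open>Geometric sums of length p modulo p and p^2\<close>

text \<open>Multiplying the sum by n - 1 gives n^p - 1, and n^p is congruent to n by Fermat.\<close>

lemma cong_1_if_dvd_geometric_sum:
  fixes p n :: nat
  assumes p: "prime p" and dvd: "p dvd (\<Sum>i<p. n ^ i)"
  shows "[n = 1] (mod p)"
proof -
  have "int p dvd (int n - 1) * (\<Sum>i<p. int n ^ i)"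
    using dvd by (intro dvd_mult) (metis (no_types) int_dvd_int_iff of_nat_power of_nat_sum sum.cong)
  then have "int p dvd int n ^ p - 1" by (simp add: power_diff_1_eq)
  moreover have "[n ^ p = n] (mod p)"
  proof (cases "p dvd n")
    case True
    then have "p dvd n ^ p" using p by (auto intro: dvd_power_le dvd_trans simp: prime_gt_0_nat)
    with True show ?thesis by (simp add: cong_def mod_eq_0_iff_dvd dvd_imp_mod_0)
  next
    case False
    then have "[n * n ^ (p - 1) = n * 1] (mod p)"
      using p by (intro cong_scalar_left fermat_theorem)
    then show ?thesis using p by (simp add: prime_gt_0_nat flip: power_eq_if power_Suc)
  qed
  then have "int p dvd int n ^ p - int n"
    by (metis cong_iff_dvd_diff cong_int_iff of_nat_power)
  ultimately have "int p dvd (int n ^ p - 1) - (int n ^ p - int n)" by (rule dvd_diff)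
  then show ?thesis by (metis add_diff_cancel_left' cong_iff_dvd_diff cong_int_iff diff_diff_eq2
        diff_add_cancel of_nat_1 diff_minus_eq_add add_uminus_conv_diff)
qed

text \<open>With n = 1 + p c, the power n^i is 1 + i p c modulo p^2. The linear terms add up to p c
  times p (p - 1) / 2, which vanishes modulo p^2 for odd p.\<close>

lemma geometric_sum_cong_odd:
  fixes p n :: nat
  assumes p: "odd p" and n: "[n = 1] (mod p)"
  shows "[(\<Sum>i<p. n ^ i) = p] (mod p ^ 2)"
proof -
  obtain c where c: "int n = 1 + int p * c"
    using n by (metis cong_iff_lin cong_int_iff cong_sym of_nat_1)
  have pow: "int p ^ 2 dvd int n ^ i - 1 - int i * int p * c" for i
  proof (induction i)
    case (Suc i)
    then have "int p ^ 2 dvd int n * (int n ^ i - 1 - int i * int p * c) + int p ^ 2 * (int i * c ^ 2)"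
      by simp
    also have "\<dots> = int n ^ Suc i - 1 - int (Suc i) * int p * c"
      by (simp add: c algebra_simps power2_eq_square)
    finally show ?case .
  qed simp
  \<comment> \<open>Doubling avoids the halved triangular number; the factor 2 is cancelled at the
    end because p^2 is odd.\<close>
  have "int p ^ 2 dvd 2 * (\<Sum>i<j. int n ^ i) - 2 * int j - int j * (int j - 1) * int p * c" for j
  proof (induction j)
    case (Suc j)
    from dvd_add[OF Suc dvd_mult[OF pow[of j], of 2]] show ?case by (simp add: algebra_simps)
  qed simp
  from this[of p] have "int p ^ 2 dvd
      2 * (\<Sum>i<p. int n ^ i) - 2 * int p - int p * (int p - 1) * int p * c
      + int p ^ 2 * ((int p - 1) * c)"
    by (rule dvd_add) simp
  then have "int p ^ 2 dvd 2 * ((\<Sum>i<p. int n ^ i) - int p)"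
    by (simp add: algebra_simps power2_eq_square)
  moreover have "coprime (int p ^ 2) 2" using p by simp
  ultimately have "int p ^ 2 dvd (\<Sum>i<p. int n ^ i) - int p"
    by (simp only: coprime_dvd_mult_right_iff)
  then have "[int (\<Sum>i<p. n ^ i) = int p] (mod int (p ^ 2))"
    by (simp add: cong_iff_dvd_diff)
  then show ?thesis by (simp only: cong_int_iff)
qed

section \<open>Lifting transitivity by one power of p\<close>

lemma padic_p_power_Suc_dvd_iff:
  fixes x :: "'p :: prime_card padic_int"
  assumes "padic_p ^ Suc k dvd x - padic_p ^ k * of_nat a"
  shows "padic_p ^ Suc k dvd x \<longleftrightarrow> CARD('p) dvd a"
proof -
  have "padic_p ^ Suc k dvd x \<longleftrightarrow> padic_p ^ Suc k dvd (padic_p ^ k * of_nat a :: 'p padic_int)"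
    using dvd_add_right_iff[OF assms, of "padic_p ^ k * of_nat a"] by simp
  also have "\<dots> \<longleftrightarrow> padic_p ^ k * padic_p ^ 1 dvd (padic_p ^ k * of_nat a :: 'p padic_int)"
    by (simp add: mult.commute)
  also have "\<dots> \<longleftrightarrow> padic_p ^ 1 dvd (of_nat a :: 'p padic_int)"
    by (subst dvd_mult_cancel_left) simp
  finally show ?thesis unfolding padic_p_power_dvd_of_nat_iff by simp
qed

text \<open>The derivative \<open>E\<close> of the iterate is a parameter so that for p = 2 the
  caller can supply one whose value at 0 is known to be 1 modulo 4.\<close>

lemma transitive_mod_Suc:
  fixes f :: "'p :: prime_card padic_int \<Rightarrow> 'p padic_int"
  assumes f: "integral_derivative_mod 2 f N D" and M: "N \<le> M"
    and E: "integral_derivative_mod 2 (f ^^ (CARD('p) ^ M)) N E"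
    and trans: "transitive_mod (Suc M) f"
    and parity: "odd CARD('p) \<or> CARD('p) = 2 \<and> padic_p ^ 2 dvd E 0 - 1"
  shows "transitive_mod (Suc (Suc M)) f"
proof -
  let ?q = "CARD('p)" and ?M2 = "Suc (Suc M)"
  have q: "prime ?q" by (rule prime_card)
  define g where "g = f ^^ (?q ^ M)"
  define G where "G = g ^^ ?q"
  have G_pow: "G ^^ j = f ^^ (?q ^ Suc M * j)" for j
    by (simp add: G_def g_def funpow_mult ac_simps)
  have ret: "padic_p ^ Suc M dvd (f ^^ i) 0 \<longleftrightarrow> ?q ^ Suc M dvd i" for i
    using trans M by (simp only: transitive_mod_iff_return_times[OF f] le_SucI)
  have "transitive_mod M f" using transitive_mod_antimono[OF f M _ trans] by simp
  then have "padic_p ^ M dvd g 0"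
    using M by (simp add: transitive_mod_iff_return_times[OF f] g_def)
  then obtain b where b: "g 0 = padic_p ^ M * b" by (auto elim: dvdE)
  \<comment> \<open>Natural numbers correct modulo p^2 suffice for \<open>E 0\<close> and
    \<open>b\<close>, as both get multiplied by multiples of p^M and only p^(M+2) matters.\<close>
  obtain n where n: "padic_p ^ 2 dvd E 0 - of_nat n" by (rule padic_int_approx_nat)
  obtain m where m: "padic_p ^ 2 dvd b - of_nat m" by (rule padic_int_approx_nat)
  have M2: "padic_p ^ ?M2 = padic_p ^ M * (padic_p ^ 2 :: 'p padic_int)"
    by (simp add: power2_eq_square ac_simps)
  have affine: "padic_p ^ ?M2 dvd g h - padic_p ^ M * of_nat m - h * of_nat n"
    if h: "padic_p ^ M dvd h" for h
  proof -
    have "padic_p ^ ?M2 dvd g h - g 0 - h * E 0"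
      using integral_derivative_modD[OF E M h, of 0] by (simp add: g_def)
    moreover have "padic_p ^ ?M2 dvd padic_p ^ M * (b - of_nat m)"
      unfolding M2 using m by (intro mult_dvd_mono) simp_all
    moreover have "padic_p ^ ?M2 dvd h * (E 0 - of_nat n)"
      unfolding M2 using h n by (rule mult_dvd_mono)
    ultimately have "padic_p ^ ?M2 dvd
        g h - g 0 - h * E 0 + padic_p ^ M * (b - of_nat m) + h * (E 0 - of_nat n)"
      by (intro dvd_add)
    then show ?thesis by (simp add: b algebra_simps)
  qed
  \<comment> \<open>\<open>affine\<close> applies only at multiples of p^M; this fact keeps the
    iterates of \<open>g\<close> there.\<close>
  have dvd_M: "padic_p ^ M dvd x" if "padic_p ^ ?M2 dvd x - padic_p ^ M * y"
    for x y :: "'p padic_int"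
  proof -
    have "padic_p ^ M dvd x - padic_p ^ M * y" using that by (rule power_le_dvd) simp
    then have "padic_p ^ M dvd x - padic_p ^ M * y + padic_p ^ M * y"
      by (rule dvd_add) simp
    then show ?thesis by simp
  qed
  have g_pow: "padic_p ^ ?M2 dvd (g ^^ j) 0 - padic_p ^ M * of_nat (m * (\<Sum>i<j. n ^ i))" for j
  proof (induction j)
    case (Suc j)
    let ?x = "(g ^^ j) 0" and ?S = "\<Sum>i<j. n ^ i"
    \<comment> \<open>The Horner form matches one application of the affine map.\<close>
    have S: "(\<Sum>i<Suc j. n ^ i) = 1 + ?S * n"
      by (simp only: sum.lessThan_Suc_shift sum_distrib_right) (simp add: ac_simps)
    have "padic_p ^ ?M2 dvd (g ?x - padic_p ^ M * of_nat m - ?x * of_nat n)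
        + (?x - padic_p ^ M * of_nat (m * ?S)) * of_nat n"
      by (intro dvd_add affine dvd_M[OF Suc] dvd_mult2 Suc)
    then show ?case unfolding S by (simp add: algebra_simps)
  qed simp
  have dvd_g_pow: "padic_p ^ Suc M dvd (g ^^ j) 0 \<longleftrightarrow> ?q dvd m * (\<Sum>i<j. n ^ i)" for j
    by (rule padic_p_power_Suc_dvd_iff, rule power_le_dvd, rule g_pow) simp
  \<comment> \<open>Modulo p^(M+1) the time p^M is no return, which makes \<open>m\<close> a unit;
    the time p^(M+1) is one, which makes the geometric sum vanish modulo p.\<close>
  have "\<not> ?q ^ Suc M dvd ?q ^ M"
    using prime_gt_1_nat[OF q] by (meson Suc_n_not_le_n power_dvd_imp_le)
  then have "\<not> padic_p ^ Suc M dvd g 0" by (simp only: g_def ret simp_thms)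
  then have q_m: "\<not> ?q dvd m" using dvd_g_pow[of 1] by simp
  have "padic_p ^ Suc M dvd G 0" using ret[of "?q ^ Suc M"] G_pow[of 1] by simp
  then have "?q dvd (\<Sum>i<?q. n ^ i)"
    using q_m dvd_g_pow[of ?q] q by (simp add: G_def prime_dvd_mult_iff)
  then have n1: "[n = 1] (mod ?q)" by (rule cong_1_if_dvd_geometric_sum[OF q])
  have "[(\<Sum>i<?q. n ^ i) = ?q] (mod ?q ^ 2)"
    using parity
  proof
    assume "odd ?q"
    then show ?thesis using n1 by (rule geometric_sum_cong_odd)
  next
    assume 2: "?q = 2 \<and> padic_p ^ 2 dvd E 0 - 1"
    then have "padic_p ^ 2 dvd (E 0 - 1) - (E 0 - of_nat n)"
      using n dvd_diff by blast
    then have "padic_p ^ 2 dvd of_nat n - (of_nat 1 :: 'p padic_int)" by simp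
    then have "[n = 1] (mod ?q ^ 2)" by (simp only: padic_p_power_dvd_of_nat_diff_iff)
    then have "[1 + n = 1 + 1] (mod ?q ^ 2)" by (intro cong_add cong_refl)
    then show ?thesis using 2 by (simp add: numeral_2_eq_2)
  qed
  then have "[m * (\<Sum>i<?q. n ^ i) = m * ?q] (mod ?q ^ 2)" by (rule cong_scalar_left)
  then have "padic_p ^ 2 dvd of_nat (m * (\<Sum>i<?q. n ^ i)) - (of_nat (m * ?q) :: 'p padic_int)"
    by (simp only: padic_p_power_dvd_of_nat_diff_iff)
  then have "padic_p ^ ?M2 dvd
      padic_p ^ M * (of_nat (m * (\<Sum>i<?q. n ^ i)) - (of_nat (m * ?q) :: 'p padic_int))"
    unfolding M2 by (intro mult_dvd_mono) simp_all
  with g_pow[of ?q] have "padic_p ^ ?M2 dvd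
      ((g ^^ ?q) 0 - padic_p ^ M * of_nat (m * (\<Sum>i<?q. n ^ i)))
      + padic_p ^ M * (of_nat (m * (\<Sum>i<?q. n ^ i)) - of_nat (m * ?q))"
    by (rule dvd_add)
  then have G0: "padic_p ^ ?M2 dvd G 0 - padic_p ^ Suc M * of_nat m"
    by (simp add: G_def algebra_simps)
  have n1': "padic_p ^ 1 dvd of_nat n - (of_nat 1 :: 'p padic_int)"
    unfolding padic_p_power_dvd_of_nat_diff_iff using n1 by simp
  \<comment> \<open>Subtracting the affine formulas at the two points leaves the error
    \<open>h * (n - 1)\<close>, where p^(M+1) divides \<open>h\<close> and p divides
    \<open>n - 1\<close>.\<close>
  have g_translate: "padic_p ^ ?M2 dvd (g ^^ j) h - (g ^^ j) 0 - h"
    if h: "padic_p ^ Suc M dvd h" for h j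
  proof (induction j)
    case (Suc j)
    let ?x = "(g ^^ j) h" and ?y = "(g ^^ j) 0"
    have y: "padic_p ^ M dvd ?y" by (rule dvd_M[OF g_pow])
    have "padic_p ^ M dvd ?x - ?y - h" using Suc by (rule power_le_dvd) simp
    moreover have "padic_p ^ M dvd h" using h by (rule power_le_dvd) simp
    ultimately have "padic_p ^ M dvd (?x - ?y - h) + ?y + h" using y by (intro dvd_add)
    then have x: "padic_p ^ M dvd ?x" by simp
    have "padic_p ^ Suc M * padic_p ^ 1 dvd h * (of_nat n - of_nat 1)"
      using h n1' by (rule mult_dvd_mono)
    then have hn: "padic_p ^ ?M2 dvd h * (of_nat n - of_nat 1)" by (simp add: ac_simps)
    have "padic_p ^ ?M2 dvd
        (g ?x - padic_p ^ M * of_nat m - ?x * of_nat n)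
        - (g ?y - padic_p ^ M * of_nat m - ?y * of_nat n)
        + (?x - ?y - h) * of_nat n + h * (of_nat n - of_nat 1)"
      by (rule dvd_add[OF dvd_add[OF dvd_diff[OF affine[OF x] affine[OF y]] dvd_mult2[OF Suc]] hn])
    then show ?case by (simp add: algebra_simps)
  qed simp
  have G_iter: "padic_p ^ ?M2 dvd (G ^^ j) 0 - padic_p ^ Suc M * of_nat (j * m)" for j
  proof (induction j)
    case (Suc j)
    let ?x = "(G ^^ j) 0"
    have x: "padic_p ^ Suc M dvd ?x" unfolding G_pow ret by simp
    have "padic_p ^ ?M2 dvd (G ?x - G 0 - ?x) + (G 0 - padic_p ^ Suc M * of_nat m)
        + (?x - padic_p ^ Suc M * of_nat (j * m))"
      by (intro dvd_add G0 Suc g_translate[OF x, of ?q, folded G_def])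
    then show ?case by (simp add: algebra_simps)
  qed simp
  \<comment> \<open>A return modulo p^(M+2) is one modulo p^(M+1), so only multiples of p^(M+1) need
    \<open>G_iter\<close>; there the unit \<open>m\<close> drops out.\<close>
  have "padic_p ^ ?M2 dvd (f ^^ i) 0 \<longleftrightarrow> ?q ^ ?M2 dvd i" for i
  proof (cases "?q ^ Suc M dvd i")
    case True
    then obtain j where j: "i = ?q ^ Suc M * j" by (auto elim: dvdE)
    have "padic_p ^ ?M2 dvd (f ^^ i) 0 \<longleftrightarrow> ?q dvd j * m"
      unfolding j G_pow[symmetric] by (rule padic_p_power_Suc_dvd_iff[OF G_iter])
    also have "\<dots> \<longleftrightarrow> ?q dvd j" using q_m q by (simp add: prime_dvd_mult_iff)
    also have "\<dots> \<longleftrightarrow> ?q ^ Suc M * ?q dvd i"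
      unfolding j by (subst nat_mult_dvd_cancel_disj) simp
    finally show ?thesis by (simp add: ac_simps)
  next
    case False
    moreover from False have "\<not> padic_p ^ Suc M dvd (f ^^ i) 0" by (simp only: ret simp_thms)
    moreover have "\<not> ?q ^ ?M2 dvd i" using False by (metis le_SucI order_refl power_le_dvd)
    ultimately show ?thesis by (metis le_SucI order_refl power_le_dvd)
  qed
  then show ?thesis using M by (simp only: transitive_mod_iff_return_times[OF f] le_SucI simp_thms)
qed

text \<open>The iterate used has order p^(k-1), and k - 1 must be at least \<open>N\<close>; hence
  the threshold \<open>Suc N\<close>.\<close>

lemma transitive_mod_Suc_odd:
  fixes f :: "'p :: prime_card padic_int \<Rightarrow> 'p padic_int"
  assumes f: "integral_derivative_mod 2 f N D" and k: "Suc N \<le> k"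
    and trans: "transitive_mod k f" and p: "odd CARD('p)"
  shows "transitive_mod (Suc k) f"
proof -
  obtain M where M: "k = Suc M" "N \<le> M" using k by (cases k) auto
  obtain E where "integral_derivative_mod 2 (f ^^ (CARD('p) ^ M)) N E"
    by (rule integral_derivative_mod_funpow[OF f])
  from transitive_mod_Suc[OF f M(2) this] trans p M(1) show ?thesis by simp
qed

text \<open>The iterate of order 2^(k-1) is split as \<open>g \<circ> g\<close>. Periodicity of the
  derivative of \<open>g\<close> requires 2^N to divide \<open>g 0\<close>, so \<open>g\<close> must
  have order at least 2^N; hence the threshold \<open>Suc (Suc N)\<close>.\<close>

lemma transitive_mod_Suc_2:
  fixes f :: "'p :: prime_card padic_int \<Rightarrow> 'p padic_int"
  assumes f: "integral_derivative_mod 2 f N D" and k: "Suc (Suc N) \<le> k"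
    and trans: "transitive_mod k f" and p: "CARD('p) = 2"
  shows "transitive_mod (Suc k) f"
proof -
  obtain M where M: "k = Suc (Suc M)" "N \<le> M" using k by (metis Suc_le_D Suc_le_mono)
  define g where "g = f ^^ (CARD('p) ^ M)"
  obtain E where E: "integral_derivative_mod 2 g N E"
    unfolding g_def by (rule integral_derivative_mod_funpow[OF f])
  have gg: "f ^^ (CARD('p) ^ Suc M) = g \<circ> g"
    by (simp add: g_def p mult_2 funpow_add)
  note ret = transitive_mod_iff_return_times[OF f, THEN iffD1, rule_format]
  have "transitive_mod M f" using transitive_mod_antimono[OF f M(2) _ trans] M(1) by simp
  then have g0: "padic_p ^ M dvd g 0" using ret[of M "2 ^ M"] M(2) by (simp add: g_def p)
  have M1: "transitive_mod (Suc M) f"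
    using transitive_mod_antimono[OF f _ _ trans, of "Suc M"] M by simp
  \<comment> \<open>The derivative of \<open>g \<circ> g\<close> at 0 is a square modulo 4 because \<open>E\<close> has period \<open>2\<^sup>N\<close>.\<close>
  have "padic_p ^ 2 dvd E (0 + g 0) - E 0"
    by (rule integral_derivative_mod_periodic[OF E]) (rule power_le_dvd[OF g0 M(2)])
  then have sq: "padic_p ^ 2 dvd (E (g 0) - E 0) * E 0" by (simp add: dvd_mult2)
  obtain n where n: "padic_p ^ 2 dvd E 0 - of_nat n" by (rule padic_int_approx_nat)
  \<comment> \<open>For even \<open>n\<close> the linear term \<open>g 0 * E 0\<close> vanishes
    modulo 2^(M+1), so \<open>g (g 0)\<close> and \<open>g 0\<close> agree there. The former is a
    return to 0, so 2^M would be a return time modulo 2^(M+1).\<close>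
  have "odd n"
  proof
    assume "even n"
    then have "padic_p ^ 1 dvd (of_nat n :: 'p padic_int)"
      unfolding padic_p_power_dvd_of_nat_iff by (simp add: p)
    moreover have "padic_p ^ 1 dvd E 0 - of_nat n" using n by (rule power_le_dvd) simp
    ultimately have "padic_p ^ 1 dvd E 0 - of_nat n + of_nat n" by (intro dvd_add)
    then have "padic_p ^ M * padic_p ^ 1 dvd g 0 * E 0" using g0 by (intro mult_dvd_mono) simp_all
    moreover have "padic_p ^ Suc M dvd g (0 + g 0) - g 0 - g 0 * E 0"
      using integral_derivative_modD[OF E M(2) g0, of 0] by (rule power_le_dvd) simp
    ultimately have "padic_p ^ Suc M dvd (g (0 + g 0) - g 0 - g 0 * E 0) + g 0 * E 0"
      by (intro dvd_add) (simp_all add: ac_simps)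
    then have "padic_p ^ Suc M dvd (g \<circ> g) 0 - g 0" by simp
    moreover have "padic_p ^ Suc M dvd (g \<circ> g) 0"
      unfolding gg[symmetric] using ret[OF _ M1, of "CARD('p) ^ Suc M"] M(2) by simp
    ultimately have "padic_p ^ Suc M dvd (g \<circ> g) 0 - ((g \<circ> g) 0 - g 0)"
      by (rule dvd_diff[rotated])
    then have "CARD('p) ^ Suc M dvd CARD('p) ^ M"
      using ret[OF _ M1, of "CARD('p) ^ M"] M(2) by (simp add: g_def)
    then show False by (auto simp: p dest: dvd_imp_le)
  qed
  then obtain c where "n = 2 * c + 1" by (rule oddE)
  then have "n * n = 1 + 4 * (c * c + c)" by (simp add: algebra_simps)
  then have "[n * n = 1] (mod CARD('p) ^ 2)" by (simp only: p cong_def) simp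
  then have nn: "padic_p ^ 2 dvd of_nat (n * n) - (of_nat 1 :: 'p padic_int)"
    by (simp only: padic_p_power_dvd_of_nat_diff_iff)
  \<comment> \<open>The sum telescopes from \<open>E (g 0) * E 0\<close> through
    \<open>E 0 * E 0\<close> and \<open>n * n\<close> down to 1.\<close>
  have "padic_p ^ 2 dvd (E (g 0) - E 0) * E 0
      + (E 0 - of_nat n) * (E 0 + of_nat n) + (of_nat (n * n) - of_nat 1)"
    by (rule dvd_add[OF dvd_add[OF sq dvd_mult2[OF n]] nn])
  then have "padic_p ^ 2 dvd E (g 0) * E 0 - 1" by (simp add: algebra_simps)
  moreover have "integral_derivative_mod 2 (f ^^ (CARD('p) ^ Suc M)) N (\<lambda>u. E (g u) * E u)"
    unfolding gg by (rule integral_derivative_mod_comp[OF E E])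
  ultimately show ?thesis
    using transitive_mod_Suc[OF f, of "Suc M"] trans p M by simp
qed

section \<open>From one level to all higher levels\<close>

text \<open>Transitivity descends from any high level to \<open>k\<close> because \<open>k\<close>
  is at least \<open>N\<close>, and climbs from \<open>k\<close> by induction with
  \<open>step\<close>.\<close>

lemma asymptotically_ergodic_iff_transitive_mod:
  assumes f: "integral_derivative_mod l f N D" and k: "N \<le> k"
    and step: "\<And>j. k \<le> j \<Longrightarrow> transitive_mod j f \<Longrightarrow> transitive_mod (Suc j) f"
  shows "asymptotically_ergodic f \<longleftrightarrow> transitive_mod k f"
proof
  assume "asymptotically_ergodic f"
  then obtain k0 where "transitive_mod (max k0 k) f"
    unfolding asymptotically_ergodic_def by (meson max.cobounded1)
  then show "transitive_mod k f" by (rule transitive_mod_antimono[OF f k, rotated]) simp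
next
  assume k: "transitive_mod k f"
  have "transitive_mod j f" if "k \<le> j" for j
    using that by (induction j rule: dec_induct) (simp_all add: k step)
  then show "asymptotically_ergodic f" by (auto simp: asymptotically_ergodic_def)
qed

theorem theorem3p14:
  fixes f :: "'p :: prime_card padic_int \<Rightarrow> 'p padic_int"
  assumes "uniformly_differentiable_mod 2 f"
    and "integer_valued_derivative_mod 2 f"
  shows "(odd CARD('p) \<longrightarrow>
            (asymptotically_ergodic f \<longleftrightarrow> transitive_mod (N_mod 2 f + 1) f)) \<and>
         (CARD('p) = 2 \<longrightarrow>
            (asymptotically_ergodic f \<longleftrightarrow> transitive_mod (N_mod 2 f + 2) f))"
proof -
  obtain D where D: "integral_derivative_mod 2 f (N_mod 2 f) D"
    by (rule integral_derivative_mod_N_mod[OF assms])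
  show ?thesis
    by (intro conjI impI asymptotically_ergodic_iff_transitive_mod[OF D]
        transitive_mod_Suc_odd[OF D] transitive_mod_Suc_2[OF D]) simp_all
qed

end
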